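(* Let $A\in\mathbb{R}[\mathtt{x}]^{\alpha\times\alpha}$ be a linear pencil in the variables $\mathtt{x}=(\mathtt{x}_1,\dots,\mathtt{x}_n)$. The following are equivalent: (i) $S_A$ has empty interior in $\mathbb{R}^n$; (ii) there exist a non-zero polynomial $f\in\mathbb{R}[\mathtt{x}]_1$ and a quadratic sos-matrix $S\in\mathbb{R}[\mathtt{x}]_2^{\alpha\times\alpha}$ such that $-f^2=\operatorname{tr}(AS)$.
   Context: Let $\mathtt{x}=(\mathtt{x}_1,\dots,\mathtt{x}_n)$ be commuting variables, $\mathbb{R}[\mathtt{x}]$ the polynomial ring and $\mathbb{R}[\mathtt{x}]_k$ the space of polynomials of degree at most $k$ (so "linear" polynomials, i.e. elements of $\mathbb{R}[\mathtt{x}]_1$, may be constant). A linear pencil of size $\alpha$ is a symmetric matrix $A\in\mathbb{R}[\mathtt{x}]^{\alpha\times\alpha}$ with entries in $\mathbb{R}[\mathtt{x}]_1$; its spectrahedron is $S_A:=\{x\in\mathbb{R}^n\mid A(x)\succeq0\}$ ($\succeq0$ means positive semidefinite). An sos-matrix of size $\alpha$ is a matrix of the form $P^*P$ with $P\in\mathbb{R}[\mathtt{x}]^{t\times\alpha}$ for some $t\in\mathbb{N}$ ($^*$ is transpose); it is quadratic if all its entries have degree at most $2$. *)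

theory Defs
  imports
    "HOL-Analysis.Analysis"
    "HOL-Library.Poly_Mapping"
    "Jordan_Normal_Form.Matrix"
begin

text \<open>
  The polynomial ring in finitely many variables indexed by the finite type \<open>'n\<close> is the
  monoid algebra of finitely supported exponent vectors; points are elements of \<open>real ^ 'n\<close>.
  Matrices are those of \<^theory>\<open>Jordan_Normal_Form.Matrix\<close>, so that row and column numbers
  can be quantified over.
\<close>

type_synonym 'n rpoly = "('n \<Rightarrow>\<^sub>0 nat) \<Rightarrow>\<^sub>0 real"

definition polys_deg_le :: "nat \<Rightarrow> ('n::finite) rpoly set" where
  "polys_deg_le k = {p. \<forall>m \<in> Poly_Mapping.keys p. (\<Sum>i\<in>UNIV. Poly_Mapping.lookup m i) \<le> k}"

definition peval :: "real ^ 'n \<Rightarrow> ('n::finite) rpoly \<Rightarrow> real" where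
  "peval x p = (\<Sum>m \<in> Poly_Mapping.keys p.
     Poly_Mapping.lookup p m * (\<Prod>i\<in>UNIV. vec_nth x i ^ Poly_Mapping.lookup m i))"

definition psd_mat :: "real mat \<Rightarrow> bool" where
  "psd_mat M \<longleftrightarrow> square_mat M \<and> transpose_mat M = M \<and>
     (\<forall>v \<in> carrier_vec (dim_row M). scalar_prod v (M *\<^sub>v v) \<ge> 0)"

text \<open>The trace in \<^theory>\<open>HOL-Analysis.Determinants\<close> is only for type-indexed matrices.\<close>

definition mat_trace :: "'a::comm_monoid_add mat \<Rightarrow> 'a" where
  "mat_trace M = (\<Sum>i < dim_row M. M $$ (i, i))"

definition linear_pencil :: "nat \<Rightarrow> ('n::finite) rpoly mat \<Rightarrow> bool" where
  "linear_pencil \<alpha> A \<longleftrightarrow>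
     A \<in> carrier_mat \<alpha> \<alpha> \<and> transpose_mat A = A \<and> elements_mat A \<subseteq> polys_deg_le 1"

definition spectrahedron :: "('n::finite) rpoly mat \<Rightarrow> (real ^ 'n) set" where
  "spectrahedron A = {x. psd_mat (map_mat (peval x) A)}"

definition sos_matrix :: "nat \<Rightarrow> ('n::finite) rpoly mat \<Rightarrow> bool" where
  "sos_matrix \<alpha> S \<longleftrightarrow> (\<exists>t. \<exists>P \<in> carrier_mat t \<alpha>. S = transpose_mat P * P)"

definition quadratic_sos_matrix :: "nat \<Rightarrow> ('n::finite) rpoly mat \<Rightarrow> bool" where
  "quadratic_sos_matrix \<alpha> S \<longleftrightarrow> sos_matrix \<alpha> S \<and> elements_mat S \<subseteq> polys_deg_le 2"

end

theory Submission
  imports Defs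
begin

text \<open>
  If \<open>x\<close> is interior to \<open>S\<^sub>A\<close>, then \<open>- f\<^sup>2 = tr (A S)\<close> is nonnegative near \<open>x\<close>, so the affine
  polynomial \<open>f\<close> vanishes on an open set and is zero.

  Conversely, consider the convex cone \<open>C\<close> of all finite sums of affine polynomials \<open>u\<^sup>T A u\<close> with
  constant vectors \<open>u\<close>. There are three obstructions to an interior point, and each gives a
  certificate:
  \<^item> \<open>C\<close> contains a negative constant \<open>- t\<close>: take \<open>f = sqrt t\<close> and constant \<open>S\<close>.
  \<^item> \<open>C\<close> contains \<open>G\<close> and \<open>- G\<close> with \<open>G \<noteq> 0\<close>: with \<open>p = (G - 1) / 2\<close> and \<open>q = (- 1 - G) / 2\<close> one
    has \<open>p\<^sup>2 G + q\<^sup>2 (- G) = (p + q) (p - q) G = - G\<^sup>2\<close>.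
  \<^item> \<open>u\<^sup>T A u = 0\<close> but \<open>f = e\<^sub>i\<^sup>T A u \<noteq> 0\<close>: with \<open>p = - (1 + A\<^sub>i\<^sub>i) / 2\<close> and \<open>r = p u + f e\<^sub>i\<close> one has
    \<open>r\<^sup>T A r = 2 p f\<^sup>2 + f\<^sup>2 A\<^sub>i\<^sub>i = - f\<^sup>2\<close>.

  If none of these occurs, the values \<open>u\<^sup>T A u\<close> on the unit sphere of a complement of the common
  kernel of \<open>A\<close> have a compact convex hull that misses the negative constants and \<open>0\<close>. A strictly
  separating functional, perturbed so as to be positive on \<open>1\<close>, is up to scaling the evaluation
  at an interior point of \<open>S\<^sub>A\<close>.
\<close>

subsection \<open>Cones of values of vector-valued quadratic forms\<close>

text \<open>The entries \<open>a i j\<close> are vectors so that the coefficient vectors of the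
  entries of a pencil can be plugged in; the values then live in a Euclidean space, where separation
  theorems apply.\<close>

definition quad_form :: "nat \<Rightarrow> (nat \<Rightarrow> nat \<Rightarrow> 'b::real_vector) \<Rightarrow> (nat \<Rightarrow> real) \<Rightarrow> 'b" where
  "quad_form \<alpha> a u = (\<Sum>i<\<alpha>. \<Sum>j<\<alpha>. (u i * u j) *\<^sub>R a i j)"

text \<open>When \<open>a i j\<close> collects coefficients, this is the common kernel of all
  coefficient matrices of the pencil.\<close>

definition in_kernel :: "nat \<Rightarrow> (nat \<Rightarrow> nat \<Rightarrow> 'b::real_vector) \<Rightarrow> (nat \<Rightarrow> real) \<Rightarrow> bool" where
  "in_kernel \<alpha> a u \<longleftrightarrow> (\<forall>i<\<alpha>. (\<Sum>j<\<alpha>. u j *\<^sub>R a i j) = 0)"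

text \<open>Plain sums over lists suffice for a cone: a nonnegative factor \<open>c\<close> is
  absorbed by scaling the argument with \<open>sqrt c\<close>.\<close>

definition quad_cone :: "nat \<Rightarrow> (nat \<Rightarrow> nat \<Rightarrow> 'b::real_vector) \<Rightarrow> 'b set" where
  "quad_cone \<alpha> a = range (\<lambda>us. \<Sum>u\<leftarrow>us. quad_form \<alpha> a u)"

lemma quad_form_scale: "quad_form \<alpha> a (\<lambda>i. c * u i) = c\<^sup>2 *\<^sub>R quad_form \<alpha> a u"
  by (simp add: quad_form_def scaleR_sum_right power2_eq_square mult_ac)

lemma quad_form_eq_outer: "quad_form \<alpha> a u = (\<Sum>i<\<alpha>. u i *\<^sub>R (\<Sum>j<\<alpha>. u j *\<^sub>R a i j))"
  by (simp add: quad_form_def scaleR_sum_right)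

text \<open>In the expansion of the form at \<open>u + n\<close>, the terms with \<open>n\<close> on
  the right vanish by the kernel condition, and symmetry moves the remaining \<open>n\<close> from
  the left to the right.\<close>

lemma quad_form_add_kernel:
  assumes sym: "\<And>i j. i < \<alpha> \<Longrightarrow> j < \<alpha> \<Longrightarrow> a i j = a j i" and k: "in_kernel \<alpha> a n"
  shows "quad_form \<alpha> a (\<lambda>i. u i + n i) = quad_form \<alpha> a u"
proof -
  have r: "(\<Sum>j<\<alpha>. (u j + n j) *\<^sub>R a i j) = (\<Sum>j<\<alpha>. u j *\<^sub>R a i j)" if "i < \<alpha>" for i
    using k that by (simp add: in_kernel_def scaleR_add_left sum.distrib)
  have "(\<Sum>i<\<alpha>. n i *\<^sub>R (\<Sum>j<\<alpha>. u j *\<^sub>R a i j)) = (\<Sum>i<\<alpha>. \<Sum>j<\<alpha>. u j *\<^sub>R n i *\<^sub>R a i j)"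
    by (simp add: scaleR_sum_right mult.commute)
  also have "\<dots> = (\<Sum>j<\<alpha>. \<Sum>i<\<alpha>. u j *\<^sub>R n i *\<^sub>R a j i)"
    by (subst sum.swap) (intro sum.cong refl, simp add: sym)
  also have "\<dots> = (\<Sum>j<\<alpha>. u j *\<^sub>R (\<Sum>i<\<alpha>. n i *\<^sub>R a j i))"
    by (simp add: scaleR_sum_right)
  also have "\<dots> = 0"
    using k by (simp add: in_kernel_def)
  finally have z: "(\<Sum>i<\<alpha>. n i *\<^sub>R (\<Sum>j<\<alpha>. u j *\<^sub>R a i j)) = 0" .
  have "quad_form \<alpha> a (\<lambda>i. u i + n i) = (\<Sum>i<\<alpha>. (u i + n i) *\<^sub>R (\<Sum>j<\<alpha>. u j *\<^sub>R a i j))"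
    unfolding quad_form_eq_outer by (intro sum.cong refl) (simp add: r)
  also have "\<dots> = quad_form \<alpha> a u + (\<Sum>i<\<alpha>. n i *\<^sub>R (\<Sum>j<\<alpha>. u j *\<^sub>R a i j))"
    by (simp add: quad_form_eq_outer scaleR_add_left sum.distrib)
  finally show ?thesis using z by simp
qed

text \<open>A minimal set of coordinates that still represents every vector modulo the kernel
  spans a complement of the kernel.\<close>

lemma kernel_complement:
  obtains I where "finite I"
    and "\<And>u. \<exists>v. (\<forall>j. j \<notin> I \<longrightarrow> v j = 0) \<and> in_kernel \<alpha> a (\<lambda>i. u i - v i)"
    and "\<And>u. \<lbrakk>\<forall>j. j \<notin> I \<longrightarrow> u j = 0; in_kernel \<alpha> a u\<rbrakk> \<Longrightarrow> u = (\<lambda>_. 0)"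
proof -
  define Q where "Q I \<longleftrightarrow> finite I \<and> (\<forall>u. \<exists>v. (\<forall>j. j \<notin> I \<longrightarrow> v j = 0) \<and> in_kernel \<alpha> a (\<lambda>i. u i - v i))" for I
  have "Q {..<\<alpha>}"
    unfolding Q_def
  proof (intro conjI allI)
    fix u :: "nat \<Rightarrow> real"
    show "\<exists>v. (\<forall>j. j \<notin> {..<\<alpha>} \<longrightarrow> v j = 0) \<and> in_kernel \<alpha> a (\<lambda>i. u i - v i)"
      \<comment> \<open>\<open>in_kernel\<close> only sees coordinates below \<alpha>, so truncation
        changes nothing modulo the kernel.\<close>
      by (rule exI[of _ "\<lambda>i. if i < \<alpha> then u i else 0"]) (simp add: in_kernel_def)
  qed simp
  then obtain I where I: "Q I" and min: "\<And>J. Q J \<Longrightarrow> card I \<le> card J"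
    using ex_has_least_nat[of Q _ card] by metis
  have fin: "finite I" and cov: "\<And>u. \<exists>v. (\<forall>j. j \<notin> I \<longrightarrow> v j = 0) \<and> in_kernel \<alpha> a (\<lambda>i. u i - v i)"
    using I by (auto simp: Q_def)
  have inj: "u = (\<lambda>_. 0)" if u: "\<forall>j. j \<notin> I \<longrightarrow> u j = 0" "in_kernel \<alpha> a u" for u
  proof (rule ccontr)
    assume "u \<noteq> (\<lambda>_. 0)"
    then obtain k where k: "u k \<noteq> 0" by auto
    with u have kI: "k \<in> I" by blast
    have "Q (I - {k})"
      unfolding Q_def
    proof (intro conjI allI)
      fix w :: "nat \<Rightarrow> real"
      obtain v where v: "\<forall>j. j \<notin> I \<longrightarrow> v j = 0" "in_kernel \<alpha> a (\<lambda>i. w i - v i)"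
        using cov by blast
      \<comment> \<open>Subtracting this multiple of the kernel vector \<open>u\<close> clears
        coordinate \<open>k\<close> without changing the class modulo the kernel, so
        \<open>I - {k}\<close> would be a smaller set.\<close>
      let ?v = "\<lambda>j. v j - v k / u k * u j"
      have "in_kernel \<alpha> a (\<lambda>i. w i - ?v i)"
        unfolding in_kernel_def
      proof (intro allI impI)
        fix i assume i: "i < \<alpha>"
        have "(\<Sum>j<\<alpha>. (w j - ?v j) *\<^sub>R a i j)
          = (\<Sum>j<\<alpha>. (w j - v j) *\<^sub>R a i j) + (v k / u k) *\<^sub>R (\<Sum>j<\<alpha>. u j *\<^sub>R a i j)"
          by (simp add: scaleR_sum_right algebra_simps flip: sum.distrib)
        then show "(\<Sum>j<\<alpha>. (w j - ?v j) *\<^sub>R a i j) = 0"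
          using v(2) u(2) i unfolding in_kernel_def by simp
      qed
      moreover have "\<forall>j. j \<notin> I - {k} \<longrightarrow> ?v j = 0"
        using v(1) u(1) k by auto
      ultimately show "\<exists>v. (\<forall>j. j \<notin> I - {k} \<longrightarrow> v j = 0) \<and> in_kernel \<alpha> a (\<lambda>i. w i - v i)"
        by (intro exI[of _ ?v] conjI)
    qed (use fin in simp)
    from min[OF this] show False
      using fin kI by (metis card_Diff1_less leD)
  qed
  from fin cov inj show thesis by (rule that)
qed

text \<open>In the product topology on sequences the sphere is a closed subset of a box, which is
  compact by Tychonoff: the factors are [-1, 1] on \<open>I\<close> and {0} elsewhere.\<close>

lemma compact_coordinate_sphere:
  assumes "finite I"
  shows "compact {u :: nat \<Rightarrow> real. (\<forall>j. j \<notin> I \<longrightarrow> u j = 0) \<and> (\<Sum>j\<in>I. (u j)\<^sup>2) = 1}"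
proof -
  let ?B = "\<lambda>j. if j \<in> I then {-1..1} else {0::real}"
  have "compactin (product_topology (\<lambda>_. euclidean) UNIV) (PiE UNIV ?B)"
    by (subst compactin_PiE) auto
  then have "compact (PiE UNIV ?B)"
    by (simp add: euclidean_product_topology)
  moreover have "closed {u :: nat \<Rightarrow> real. (\<Sum>j\<in>I. (u j)\<^sup>2) = 1}"
    by (intro closed_Collect_eq continuous_intros continuous_on_product_coordinates)
  ultimately have "compact (PiE UNIV ?B \<inter> {u. (\<Sum>j\<in>I. (u j)\<^sup>2) = 1})"
    by (rule compact_Int_closed)
  moreover have "u j \<in> {-1..1}" if "(\<Sum>j\<in>I. (u j)\<^sup>2) = 1" "j \<in> I" for u :: "nat \<Rightarrow> real" and j
  proof -
    have "(u j)\<^sup>2 \<le> (\<Sum>j\<in>I. (u j)\<^sup>2)"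
      using assms that(2) by (intro member_le_sum) auto
    then show ?thesis
      using that(1) abs_square_le_1[of "u j"] by auto
  qed
  then have "PiE UNIV ?B \<inter> {u. (\<Sum>j\<in>I. (u j)\<^sup>2) = 1}
      = {u :: nat \<Rightarrow> real. (\<forall>j. j \<notin> I \<longrightarrow> u j = 0) \<and> (\<Sum>j\<in>I. (u j)\<^sup>2) = 1}"
    by (auto simp: PiE_iff split: if_splits)
  ultimately show ?thesis by simp
qed

section \<open>The convex cone generated by the values of a quadratic form\<close>

lemma quad_cone_add:
  assumes "x \<in> quad_cone \<alpha> a" "y \<in> quad_cone \<alpha> a"
  shows "x + y \<in> quad_cone \<alpha> a"
proof -
  from assms obtain us vs where "x = (\<Sum>u\<leftarrow>us. quad_form \<alpha> a u)" "y = (\<Sum>u\<leftarrow>vs. quad_form \<alpha> a u)"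
    by (auto simp: quad_cone_def)
  then have "x + y = (\<Sum>u\<leftarrow>us @ vs. quad_form \<alpha> a u)" by simp
  then show ?thesis unfolding quad_cone_def by blast
qed

lemma quad_cone_scale:
  assumes "x \<in> quad_cone \<alpha> a" "0 \<le> c"
  shows "c *\<^sub>R x \<in> quad_cone \<alpha> a"
proof -
  from assms obtain us where us: "x = (\<Sum>u\<leftarrow>us. quad_form \<alpha> a u)"
    by (auto simp: quad_cone_def)
  have "c *\<^sub>R x = (\<Sum>u\<leftarrow>map (\<lambda>u i. sqrt c * u i) us. quad_form \<alpha> a u)"
    unfolding us by (induction us) (use assms(2) in \<open>simp_all add: quad_form_scale scaleR_add_right\<close>)
  then show ?thesis unfolding quad_cone_def by blast
qed

lemma quad_form_in_cone: "quad_form \<alpha> a u \<in> quad_cone \<alpha> a"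
  unfolding quad_cone_def by (rule range_eqI[of _ _ "[u]"]) simp

text \<open>If a convex combination of two nonzero elements were 0, one scaled summand would be the
  negative of the other, with both in the cone.\<close>

lemma convex_pointed_cone:
  assumes pointed: "\<And>x. \<lbrakk>x \<in> quad_cone \<alpha> a; - x \<in> quad_cone \<alpha> a\<rbrakk> \<Longrightarrow> x = 0"
  shows "convex (quad_cone \<alpha> a - {0})"
proof (rule convexI)
  fix x y and s t :: real
  assume x: "x \<in> quad_cone \<alpha> a - {0}" and y: "y \<in> quad_cone \<alpha> a - {0}"
    and st: "0 \<le> s" "0 \<le> t" "s + t = 1"
  have sx: "s *\<^sub>R x \<in> quad_cone \<alpha> a" and ty: "t *\<^sub>R y \<in> quad_cone \<alpha> a"
    using x y st by (simp_all add: quad_cone_scale)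
  have "s *\<^sub>R x + t *\<^sub>R y \<noteq> 0"
  proof
    assume z: "s *\<^sub>R x + t *\<^sub>R y = 0"
    then have "- (s *\<^sub>R x) = t *\<^sub>R y" by (simp add: add_eq_0_iff)
    with pointed sx ty have "s *\<^sub>R x = 0" by metis
    with z have "s *\<^sub>R x = 0" "t *\<^sub>R y = 0" by auto
    with x y st show False by auto
  qed
  with quad_cone_add[OF sx ty] show "s *\<^sub>R x + t *\<^sub>R y \<in> quad_cone \<alpha> a - {0}" by simp
qed

text \<open>Under the pointedness and kernel conditions the cone is generated by a compact convex set
  that misses the origin, which yields strict separation from the ray \<open>-\<real>\<^sub>+ e\<close>.\<close>

lemma interior_functional:
  fixes a :: "nat \<Rightarrow> nat \<Rightarrow> 'b::euclidean_space"
  assumes sym: "\<And>i j. i < \<alpha> \<Longrightarrow> j < \<alpha> \<Longrightarrow> a i j = a j i"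
    and kernel: "\<And>u. quad_form \<alpha> a u = 0 \<Longrightarrow> in_kernel \<alpha> a u"
    and pointed: "\<And>x. \<lbrakk>x \<in> quad_cone \<alpha> a; - x \<in> quad_cone \<alpha> a\<rbrakk> \<Longrightarrow> x = 0"
    and ray: "\<And>t. t > 0 \<Longrightarrow> - (t *\<^sub>R e) \<notin> quad_cone \<alpha> a"
    and e: "e \<noteq> 0"
  obtains l r where "inner l e > 0" "r > 0"
    and "\<And>l' u. dist l l' < r \<Longrightarrow> inner l' (quad_form \<alpha> a u) \<ge> 0"
proof -
  obtain I where fin: "finite I"
    and cov: "\<And>u. \<exists>v. (\<forall>j. j \<notin> I \<longrightarrow> v j = 0) \<and> in_kernel \<alpha> a (\<lambda>i. u i - v i)"
    and inj: "\<And>u. \<lbrakk>\<forall>j. j \<notin> I \<longrightarrow> u j = 0; in_kernel \<alpha> a u\<rbrakk> \<Longrightarrow> u = (\<lambda>_. 0)"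
    using kernel_complement[of \<alpha> a] by blast
  define Sph where "Sph = {u :: nat \<Rightarrow> real. (\<forall>j. j \<notin> I \<longrightarrow> u j = 0) \<and> (\<Sum>j\<in>I. (u j)\<^sup>2) = 1}"
  define K where "K = convex hull (quad_form \<alpha> a ` Sph)"
  have "continuous_on Sph (quad_form \<alpha> a)"
    unfolding quad_form_def
    by (intro continuous_intros continuous_on_subset[OF continuous_on_product_coordinates subset_UNIV])
  then have "compact K"
    unfolding K_def Sph_def
    by (intro compact_convex_hull compact_continuous_image compact_coordinate_sphere fin)
  have "quad_form \<alpha> a ` Sph \<subseteq> quad_cone \<alpha> a - {0}"
  proof clarify
    fix u assume u: "u \<in> Sph"
    have "quad_form \<alpha> a u \<noteq> 0"
    proof
      assume "quad_form \<alpha> a u = 0"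
      from inj[OF _ kernel[OF this]] u have "u = (\<lambda>_. 0)" by (simp add: Sph_def)
      with u show False by (simp add: Sph_def)
    qed
    then show "quad_form \<alpha> a u \<in> quad_cone \<alpha> a - {0}" by (simp add: quad_form_in_cone)
  qed
  then have K_cone: "K \<subseteq> quad_cone \<alpha> a - {0}"
    unfolding K_def by (rule hull_minimal) (rule convex_pointed_cone[OF pointed])
  \<comment> \<open>Replace \<open>u\<close> by its representative \<open>v\<close> supported on
    \<open>I\<close>, then normalise \<open>v\<close>: only values on the sphere, hence points of
    \<open>K\<close>, have to be tested.\<close>
  have reduce: "inner l' (quad_form \<alpha> a u) \<ge> 0" if l': "\<And>k. k \<in> K \<Longrightarrow> inner l' k > 0" for l' u
  proof -
    obtain v where v: "\<forall>j. j \<notin> I \<longrightarrow> v j = 0" "in_kernel \<alpha> a (\<lambda>i. u i - v i)"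
      using cov by blast
    have "quad_form \<alpha> a u = quad_form \<alpha> a (\<lambda>i. v i + (u i - v i))" by simp
    also have "\<dots> = quad_form \<alpha> a v"
      using sym v(2) by (rule quad_form_add_kernel)
    finally have uv: "quad_form \<alpha> a u = quad_form \<alpha> a v" .
    define s where "s = sqrt (\<Sum>j\<in>I. (v j)\<^sup>2)"
    show ?thesis
    proof (cases "s = 0")
      case True
      then have "\<forall>j\<in>I. v j = 0"
        unfolding s_def using fin by (simp add: sum_nonneg_eq_0_iff)
      with v(1) have "v j = 0" for j by blast
      then show ?thesis unfolding uv by (simp add: quad_form_def)
    next
      case False
      have s2: "s\<^sup>2 = (\<Sum>j\<in>I. (v j)\<^sup>2)" by (simp add: s_def sum_nonneg)
      have "(\<lambda>i. v i / s) \<in> Sph"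
        using v(1) False by (simp add: Sph_def power_divide flip: sum_divide_distrib s2)
      then have "quad_form \<alpha> a (\<lambda>i. v i / s) \<in> K" by (simp add: K_def hull_inc)
      from l'[OF this] have "s\<^sup>2 * inner l' (quad_form \<alpha> a (\<lambda>i. v i / s)) \<ge> 0" by simp
      also have "s\<^sup>2 * inner l' (quad_form \<alpha> a (\<lambda>i. v i / s)) = inner l' (quad_form \<alpha> a u)"
        using False quad_form_scale[of \<alpha> a s "\<lambda>i. v i / s"] by (simp add: uv)
      finally show ?thesis .
    qed
  qed
  show thesis
  proof (cases "K = {}")
    case True
    \<comment> \<open>With \<open>K\<close> empty the premise of \<open>reduce\<close> is vacuous,
      so every functional qualifies, in particular those near \<open>e\<close>.\<close>
    then show thesis using that[of e 1] e reduce by auto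
  next
    case False
    \<comment> \<open>The ray includes 0, which forces \<open>b > 0\<close> in the separation below.
      It is disjoint from \<open>K\<close> because \<open>ray\<close> excludes its points with
      \<open>t > 0\<close> and \<open>K\<close> misses 0.\<close>
    define R where "R = (\<lambda>t. - (t *\<^sub>R e)) ` {0..}"
    have "R = (\<lambda>t. t *\<^sub>R (- e)) ` {0..}" by (simp add: R_def)
    moreover have "linear (\<lambda>t. t *\<^sub>R (- e))" by (intro linearI) (simp_all add: scaleR_add_left)
    ultimately have "convex R" "closed R"
      using e by (auto intro!: convex_linear_image closed_injective_linear_image injI)
    have disj: "R \<inter> K = {}"
    proof (intro equals0I)
      fix x assume "x \<in> R \<inter> K"
      then obtain t where "t \<ge> 0" "x = - (t *\<^sub>R e)" "x \<in> quad_cone \<alpha> a" "x \<noteq> 0"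
        using K_cone unfolding R_def by blast
      with ray[of t] show False by (cases "t = 0") auto
    qed
    obtain c b where R_less: "\<And>x. x \<in> R \<Longrightarrow> inner c x < b" and K_gr: "\<And>x. x \<in> K \<Longrightarrow> b < inner c x"
      using separating_hyperplane_closed_compact[OF \<open>convex R\<close> \<open>closed R\<close> _ \<open>compact K\<close> False disj]
      by (auto simp: K_def)
    have b: "b > 0" using R_less[of 0] by (force simp: R_def)
    have ce: "inner c e \<ge> 0"
    proof (rule ccontr)
      assume n: "\<not> inner c e \<ge> 0"
      \<comment> \<open>Chosen so that \<open>c\<close> takes exactly the value \<open>b\<close> at
        the point \<open>- (?t *\<^sub>R e)\<close> of the ray, against the strict bound
        there.\<close>
      let ?t = "b / - inner c e"
      have "?t \<ge> 0" using b n by (intro divide_nonneg_nonneg) auto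
      then have "- (?t *\<^sub>R e) \<in> R" unfolding R_def by blast
      from R_less[OF this] n show False by (simp add: field_simps)
    qed
    obtain M where M: "M > 0" "\<And>k. k \<in> K \<Longrightarrow> norm k \<le> M"
      using compact_imp_bounded[OF \<open>compact K\<close>] by (auto simp: bounded_pos)
    \<comment> \<open>By Cauchy-Schwarz, moving \<open>c\<close> by less than \<open>b / M\<close>
      lowers its values on \<open>K\<close> by at most \<open>b\<close>, and these values exceed
      \<open>b\<close>.\<close>
    have near: "inner l' (quad_form \<alpha> a u) \<ge> 0" if "dist c l' < b / M" for l' u
    proof (rule reduce)
      fix k assume k: "k \<in> K"
      have "inner (c - l') k \<le> norm (c - l') * norm k" by (rule norm_cauchy_schwarz)
      also have "\<dots> \<le> b / M * M"
        using that M k b by (intro mult_mono) (auto simp: dist_norm)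
      finally have "inner c k - inner l' k \<le> b" using M by (simp add: inner_diff_left)
      with K_gr[OF k] show "inner l' k > 0" by simp
    qed
    \<comment> \<open>The separation gives only \<open>inner c e \<ge> 0\<close>. Shifting
      \<open>c\<close> along \<open>e\<close> makes this strict; the shift uses up half of the
      radius \<open>b / M\<close> and leaves the other half for the ball.\<close>
    define \<delta> where "\<delta> = b / M / (2 * norm e)"
    have \<delta>: "\<delta> > 0" using b M e by (simp add: \<delta>_def)
    show thesis
    proof (rule that)
      show "inner (c + \<delta> *\<^sub>R e) e > 0"
        using ce \<delta> e by (simp add: inner_add_left add_nonneg_pos)
      show "b / M / 2 > 0" using b M by simp
      fix l' u assume "dist (c + \<delta> *\<^sub>R e) l' < b / M / 2"
      moreover have "dist c (c + \<delta> *\<^sub>R e) = b / M / 2"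
        using \<delta> e by (simp add: dist_norm) (simp add: \<delta>_def)
      ultimately have "dist c l' < b / M"
        using dist_triangle[of c l' "c + \<delta> *\<^sub>R e"] by simp
      then show "inner l' (quad_form \<alpha> a u) \<ge> 0" by (rule near)
    qed
  qed
qed

subsection \<open>Affine polynomials\<close>

abbreviation const_poly :: "real \<Rightarrow> ('n::finite) rpoly" where
  "const_poly c \<equiv> Poly_Mapping.single 0 c"

lemma single_1_neq_0: "Poly_Mapping.single i (1::nat) \<noteq> 0"
  by (metis lookup_single_eq lookup_zero zero_neq_one)

lemma exponent_degree_le_1_cases:
  fixes m :: "('n::finite) \<Rightarrow>\<^sub>0 nat"
  assumes "(\<Sum>i\<in>UNIV. Poly_Mapping.lookup m i) \<le> 1"
  shows "m = 0 \<or> (\<exists>i. m = Poly_Mapping.single i 1)"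
proof (cases "m = 0")
  case False
  then obtain i where i: "Poly_Mapping.lookup m i \<noteq> 0"
    by (metis poly_mapping_eqI lookup_zero)
  have "(\<Sum>i\<in>UNIV. Poly_Mapping.lookup m i)
      = Poly_Mapping.lookup m i + (\<Sum>j\<in>UNIV - {i}. Poly_Mapping.lookup m j)"
    by (simp add: sum.remove)
  with assms i have one: "Poly_Mapping.lookup m i = 1"
    and "(\<Sum>j\<in>UNIV - {i}. Poly_Mapping.lookup m j) = 0" by linarith+
  then have "\<forall>j\<in>UNIV - {i}. Poly_Mapping.lookup m j = 0" by simp
  with one have "m = Poly_Mapping.single i 1"
    by (intro poly_mapping_eqI) (auto simp: lookup_single when_def)
  then show ?thesis by blast
qed simp

lemma polys_deg_le_add: "\<lbrakk>p \<in> polys_deg_le k; q \<in> polys_deg_le k\<rbrakk> \<Longrightarrow> p + q \<in> polys_deg_le k"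
  using keys_add[of p q] unfolding polys_deg_le_def by blast

lemma polys_deg_le_uminus: "p \<in> polys_deg_le k \<Longrightarrow> - p \<in> polys_deg_le k"
  by (simp add: polys_deg_le_def)

lemma polys_deg_le_diff: "\<lbrakk>p \<in> polys_deg_le k; q \<in> polys_deg_le k\<rbrakk> \<Longrightarrow> p - q \<in> polys_deg_le k"
  using polys_deg_le_add[of p k "- q"] by (simp add: polys_deg_le_uminus)

lemma polys_deg_le_const: "const_poly c \<in> polys_deg_le k"
  by (simp add: polys_deg_le_def)

lemma polys_deg_le_0: "0 \<in> polys_deg_le k"
  by (simp add: polys_deg_le_def)

lemma polys_deg_le_1: "1 \<in> polys_deg_le k"
  using polys_deg_le_const[of 1] by simp

lemma polys_deg_le_sum: "(\<And>i. i \<in> I \<Longrightarrow> p i \<in> polys_deg_le k) \<Longrightarrow> sum p I \<in> polys_deg_le k"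
  by (induction I rule: infinite_finite_induct) (simp_all add: polys_deg_le_0 polys_deg_le_add)

lemma polys_deg_le_sum_list: "(\<And>i. p i \<in> polys_deg_le k) \<Longrightarrow> (\<Sum>i\<leftarrow>is. p i) \<in> polys_deg_le k"
  by (induction "is") (simp_all add: polys_deg_le_0 polys_deg_le_add)

lemma polys_deg_le_mult:
  assumes "p \<in> polys_deg_le k" "q \<in> polys_deg_le l"
  shows "p * q \<in> polys_deg_le (k + l)"
  unfolding polys_deg_le_def
proof clarify
  fix m assume "m \<in> Poly_Mapping.keys (p * q)"
  then obtain a b where "m = a + b" "a \<in> Poly_Mapping.keys p" "b \<in> Poly_Mapping.keys q"
    using keys_mult[of p q] by blast
  with assms show "(\<Sum>i\<in>UNIV. Poly_Mapping.lookup m i) \<le> k + l"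
    by (auto simp: polys_deg_le_def lookup_add sum.distrib intro!: add_mono)
qed

lemma polys_deg_le_const_mult:
  "p \<in> polys_deg_le k \<Longrightarrow> const_poly c * p \<in> polys_deg_le k"
  "p \<in> polys_deg_le k \<Longrightarrow> p * const_poly c \<in> polys_deg_le k"
  using polys_deg_le_mult[of "const_poly c" 0 p k] polys_deg_le_mult[of p k "const_poly c" 0]
  by (simp_all add: polys_deg_le_const)

lemmas polys_deg_le_intros = polys_deg_le_add polys_deg_le_diff polys_deg_le_const
  polys_deg_le_0 polys_deg_le_1 polys_deg_le_sum polys_deg_le_sum_list polys_deg_le_const_mult

section \<open>Evaluation as a ring homomorphism\<close>

lemma peval_superset:
  assumes "finite S" "Poly_Mapping.keys p \<subseteq> S"
  shows "peval x p = (\<Sum>m\<in>S. Poly_Mapping.lookup p m * (\<Prod>i\<in>UNIV. vec_nth x i ^ Poly_Mapping.lookup m i))"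
  unfolding peval_def using assms by (intro sum.mono_neutral_left) (auto simp: in_keys_iff)

lemma peval_zero [simp]: "peval x 0 = 0"
  by (simp add: peval_def)

lemma peval_single: "peval x (Poly_Mapping.single m c) = c * (\<Prod>i\<in>UNIV. vec_nth x i ^ Poly_Mapping.lookup m i)"
  using peval_superset[of "{m}" "Poly_Mapping.single m c" x] by simp

text \<open>Cancellation can remove keys from \<open>p + q\<close>, so all three evaluations are
  summed over the union of the two key sets.\<close>

lemma peval_add: "peval x (p + q) = peval x p + peval x q"
  using peval_superset[of "Poly_Mapping.keys p \<union> Poly_Mapping.keys q" p x]
    peval_superset[of "Poly_Mapping.keys p \<union> Poly_Mapping.keys q" q x]
    peval_superset[of "Poly_Mapping.keys p \<union> Poly_Mapping.keys q" "p + q" x] keys_add[of p q]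
  by (simp add: lookup_add distrib_right sum.distrib)

lemma peval_uminus: "peval x (- p) = - peval x p"
  using peval_add[of x p "- p"] by simp

lemma peval_sum: "peval x (sum p I) = (\<Sum>i\<in>I. peval x (p i))"
  by (induction I rule: infinite_finite_induct) (simp_all add: peval_add)

lemma sum_monomials: "p = (\<Sum>m\<in>Poly_Mapping.keys p. Poly_Mapping.single m (Poly_Mapping.lookup p m))"
  by (intro poly_mapping_eqI) (simp add: lookup_sum lookup_single when_def in_keys_iff)

text \<open>Monomials multiply by adding exponents; the general case follows by expanding both
  factors into monomials.\<close>

lemma peval_mult: "peval x (p * q) = peval x p * peval x q"
proof -
  have mono: "peval x (Poly_Mapping.single m c * Poly_Mapping.single n d)
      = peval x (Poly_Mapping.single m c) * peval x (Poly_Mapping.single n d)" for m n c d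
    by (simp add: mult_single peval_single lookup_add power_add prod.distrib mult_ac)
  let ?s = "\<lambda>p m. Poly_Mapping.single m (Poly_Mapping.lookup p m)"
  have "peval x ((\<Sum>m\<in>Poly_Mapping.keys p. ?s p m) * (\<Sum>n\<in>Poly_Mapping.keys q. ?s q n))
      = peval x (\<Sum>m\<in>Poly_Mapping.keys p. ?s p m) * peval x (\<Sum>n\<in>Poly_Mapping.keys q. ?s q n)"
    by (simp add: sum_product peval_sum mono)
  then show ?thesis by (simp flip: sum_monomials)
qed

lemma lookup_const_mult: "Poly_Mapping.lookup (const_poly c * p) m = c * Poly_Mapping.lookup p m"
  by (simp add: map.rep_eq when_def flip: mult_map_scale_conv_mult)

text \<open>Identifies the polynomials of degree at most 1 with a Euclidean space, in which
  evaluation at \<open>x\<close> is the inner product with \<open>(1, x)\<close>. Coefficients of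
  higher degree are discarded, so injectivity needs the degree bound.\<close>

definition affine_coeffs :: "('n::finite) rpoly \<Rightarrow> real \<times> (real ^ 'n)" where
  "affine_coeffs p = (Poly_Mapping.lookup p 0, \<chi> i. Poly_Mapping.lookup p (Poly_Mapping.single i 1))"

lemma affine_coeffs_add: "affine_coeffs (p + q) = affine_coeffs p + affine_coeffs q"
  by (simp add: affine_coeffs_def lookup_add Finite_Cartesian_Product.vec_eq_iff)

lemma affine_coeffs_zero [simp]: "affine_coeffs 0 = 0"
  by (simp add: affine_coeffs_def Finite_Cartesian_Product.vec_eq_iff zero_prod_def)

lemma affine_coeffs_sum: "affine_coeffs (sum p I) = (\<Sum>i\<in>I. affine_coeffs (p i))"
  by (induction I rule: infinite_finite_induct) (simp_all add: affine_coeffs_add)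

lemma affine_coeffs_sum_list: "affine_coeffs (\<Sum>i\<leftarrow>is. p i) = (\<Sum>i\<leftarrow>is. affine_coeffs (p i))"
  by (induction "is") (simp_all add: affine_coeffs_add)

lemma affine_coeffs_const_mult: "affine_coeffs (const_poly c * p) = c *\<^sub>R affine_coeffs p"
  by (simp add: affine_coeffs_def lookup_const_mult Finite_Cartesian_Product.vec_eq_iff)

lemma affine_coeffs_const: "affine_coeffs (const_poly c) = (c, 0)"
  by (simp add: affine_coeffs_def Finite_Cartesian_Product.vec_eq_iff lookup_single_not_eq single_1_neq_0[simplified, symmetric])

lemma affine_coeffs_eq_0:
  assumes "p \<in> polys_deg_le 1" "affine_coeffs p = 0"
  shows "p = 0"
proof (rule poly_mapping_eqI)
  fix m show "Poly_Mapping.lookup p m = Poly_Mapping.lookup 0 m"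
  proof (cases "m \<in> Poly_Mapping.keys p")
    case True
    with assms(1) have "m = 0 \<or> (\<exists>i. m = Poly_Mapping.single i 1)"
      by (intro exponent_degree_le_1_cases) (auto simp: polys_deg_le_def)
    with assms(2) show ?thesis by (auto simp: affine_coeffs_def zero_prod_def Finite_Cartesian_Product.vec_eq_iff)
  qed (simp add: in_keys_iff)
qed

lemma peval_affine:
  assumes "p \<in> polys_deg_le 1"
  shows "peval x p = inner (1, x) (affine_coeffs p)"
proof -
  let ?e = "\<lambda>i. Poly_Mapping.single i (1::nat)"
  have "Poly_Mapping.keys p \<subseteq> insert 0 (range ?e)"
    using assms exponent_degree_le_1_cases by (fastforce simp: polys_deg_le_def)
  then have "peval x p = (\<Sum>m\<in>insert 0 (range ?e).
      Poly_Mapping.lookup p m * (\<Prod>i\<in>UNIV. vec_nth x i ^ Poly_Mapping.lookup m i))"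
    by (intro peval_superset) auto
  also have "\<dots> = Poly_Mapping.lookup p 0 + (\<Sum>m\<in>range ?e.
      Poly_Mapping.lookup p m * (\<Prod>i\<in>UNIV. vec_nth x i ^ Poly_Mapping.lookup m i))"
    by (subst sum.insert) (auto simp: image_iff single_1_neq_0[simplified] single_1_neq_0[simplified, symmetric])
  also have "(\<Sum>m\<in>range ?e.
      Poly_Mapping.lookup p m * (\<Prod>i\<in>UNIV. vec_nth x i ^ Poly_Mapping.lookup m i))
    = (\<Sum>k\<in>UNIV. Poly_Mapping.lookup p (?e k) * (\<Prod>i\<in>UNIV. vec_nth x i ^ Poly_Mapping.lookup (?e k) i))"
    by (subst sum.reindex) (auto simp: inj_on_def dest: arg_cong[of _ _ Poly_Mapping.keys])
  also have "\<dots> = (\<Sum>k\<in>UNIV. Poly_Mapping.lookup p (?e k) * vec_nth x k)"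
  proof (intro sum.cong refl)
    fix k
    have "(\<Prod>i\<in>UNIV. vec_nth x i ^ Poly_Mapping.lookup (?e k) i) = (\<Prod>i\<in>UNIV. if i = k then vec_nth x i else 1)"
      by (intro prod.cong refl) (auto simp: lookup_single when_def)
    then show "Poly_Mapping.lookup p (?e k) * (\<Prod>i\<in>UNIV. vec_nth x i ^ Poly_Mapping.lookup (?e k) i)
        = Poly_Mapping.lookup p (?e k) * vec_nth x k" by simp
  qed
  finally show ?thesis
    by (simp add: affine_coeffs_def inner_prod_def inner_vec_def mult.commute)
qed

text \<open>Moving from a point of \<open>U\<close> in the direction of the gradient
  \<open>d\<close> changes the value by \<open>t * inner d d\<close>, which must be 0.\<close>

lemma affine_zero_on_open:
  fixes c :: "real \<times> (real ^ 'n::finite)"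
  assumes "open U" "U \<noteq> {}" and zero: "\<And>x. x \<in> U \<Longrightarrow> inner (1, x) c = 0"
  shows "c = 0"
proof -
  obtain s d where c: "c = (s, d)" by (cases c)
  obtain x e where x: "x \<in> U" "e > 0" "ball x e \<subseteq> U"
    using assms(1,2) by (meson all_not_in_conv open_contains_ball)
  \<comment> \<open>The added 1 keeps the denominator positive when \<open>d = 0\<close>; the step
    \<open>t *\<^sub>R d\<close> has length at most \<open>e / 2\<close>.\<close>
  define t where "t = e / 2 / (norm d + 1)"
  have t: "t > 0" using x by (simp add: t_def add_nonneg_pos)
  have "norm d + 1 \<noteq> 0" using norm_ge_zero[of d] by linarith
  then have half: "t * (norm d + 1) = e / 2" unfolding t_def by (metis nonzero_divide_eq_eq)
  have "norm (t *\<^sub>R d) \<le> t * (norm d + 1)" using t by simp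
  also have "\<dots> < e" unfolding half using x by simp
  finally have "norm (t *\<^sub>R d) < e" .
  then have "x + t *\<^sub>R d \<in> U" using x by (auto simp: dist_norm)
  from zero[OF this] zero[OF x(1)] have "s + (inner x d + t * inner d d) = 0" "s + inner x d = 0"
    by (simp_all add: c inner_add_left)
  then have "t * inner d d = 0" "s + inner x d = 0" by linarith+
  with t show ?thesis by (simp add: c zero_prod_def)
qed

section \<open>Pencils as quadratic forms on polynomial vectors, and traces against
  sos-matrices\<close>

definition pencil_form :: "nat \<Rightarrow> 'a::comm_ring_1 mat \<Rightarrow> (nat \<Rightarrow> 'a) \<Rightarrow> 'a" where
  "pencil_form \<alpha> A r = (\<Sum>i<\<alpha>. \<Sum>j<\<alpha>. r i * r j * A $$ (i, j))"

lemma pencil_form_scale: "pencil_form \<alpha> A (\<lambda>j. p * r j) = p ^ 2 * pencil_form \<alpha> A r"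
  by (simp add: pencil_form_def sum_distrib_left power2_eq_square mult_ac)

text \<open>Expands the form at \<open>r\<close> plus \<open>q\<close> times the \<open>i\<close>-th
  unit vector; symmetry merges the two cross terms. It serves the certificate coming from a violated
  kernel condition.\<close>

lemma pencil_form_add_unit:
  assumes sym: "\<And>j k. j < \<alpha> \<Longrightarrow> k < \<alpha> \<Longrightarrow> A $$ (j, k) = A $$ (k, j)" and i: "i < \<alpha>"
  shows "pencil_form \<alpha> A (\<lambda>j. r j + (if j = i then q else 0))
    = pencil_form \<alpha> A r + 2 * q * (\<Sum>j<\<alpha>. r j * A $$ (i, j)) + q ^ 2 * A $$ (i, i)"
proof -
  let ?d = "\<lambda>j. if j = i then q else 0"
  have delta: "(\<Sum>j<\<alpha>. ?d j * X j) = q * X i" for X :: "nat \<Rightarrow> 'a"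
    using i by (simp add: if_distrib[of "\<lambda>y. y * _"] cong: if_cong)
  have "pencil_form \<alpha> A (\<lambda>j. r j + ?d j) = pencil_form \<alpha> A r
      + (\<Sum>k<\<alpha>. r k * (\<Sum>j<\<alpha>. ?d j * A $$ (k, j)))
      + (\<Sum>k<\<alpha>. ?d k * (\<Sum>j<\<alpha>. r j * A $$ (k, j)))
      + (\<Sum>k<\<alpha>. ?d k * (\<Sum>j<\<alpha>. ?d j * A $$ (k, j)))"
    by (simp add: pencil_form_def distrib_left distrib_right sum.distrib sum_distrib_left mult_ac)
  also have "\<dots> = pencil_form \<alpha> A r + (\<Sum>k<\<alpha>. r k * (q * A $$ (k, i)))
      + q * (\<Sum>j<\<alpha>. r j * A $$ (i, j)) + q * (q * A $$ (i, i))"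
    by (simp only: delta)
  also have "(\<Sum>k<\<alpha>. r k * (q * A $$ (k, i))) = q * (\<Sum>j<\<alpha>. r j * A $$ (i, j))"
    unfolding sum_distrib_left using i by (intro sum.cong refl) (simp add: sym mult_ac)
  finally show ?thesis by (simp add: power2_eq_square algebra_simps)
qed

text \<open>The trace splits along the rows of \<open>P\<close>, each row contributing the value of
  the form at that row.\<close>

lemma mat_trace_mult_sos:
  fixes A :: "'a::comm_ring_1 mat"
  assumes "A \<in> carrier_mat \<alpha> \<alpha>" "P \<in> carrier_mat t \<alpha>"
  shows "mat_trace (A * (transpose_mat P * P)) = (\<Sum>k<t. pencil_form \<alpha> A (\<lambda>j. P $$ (k, j)))"
proof -
  have "mat_trace (A * (transpose_mat P * P))
      = (\<Sum>i<\<alpha>. \<Sum>j<\<alpha>. \<Sum>k<t. A $$ (i, j) * (P $$ (k, j) * P $$ (k, i)))"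
    using assms
    by (auto simp: mat_trace_def scalar_prod_def sum_distrib_left atLeast0LessThan intro!: sum.cong)
  also have "\<dots> = (\<Sum>i<\<alpha>. \<Sum>k<t. \<Sum>j<\<alpha>. A $$ (i, j) * (P $$ (k, j) * P $$ (k, i)))"
    by (intro sum.cong refl sum.swap)
  also have "\<dots> = (\<Sum>k<t. \<Sum>i<\<alpha>. \<Sum>j<\<alpha>. A $$ (i, j) * (P $$ (k, j) * P $$ (k, i)))"
    by (rule sum.swap)
  finally show ?thesis by (simp add: pencil_form_def mult_ac)
qed

text \<open>Stacking the vectors in \<open>rs\<close> as the rows of \<open>P\<close> reduces the
  search for \<open>S\<close> to finding a list of vectors with affine entries; products of two such
  entries have degree at most 2.\<close>

lemma quadratic_sos_matrix_of_rows:
  fixes A :: "('n::finite) rpoly mat"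
  assumes A: "A \<in> carrier_mat \<alpha> \<alpha>"
    and deg: "\<And>r j. r \<in> set rs \<Longrightarrow> r j \<in> polys_deg_le 1"
  obtains S where "quadratic_sos_matrix \<alpha> S" "mat_trace (A * S) = (\<Sum>r\<leftarrow>rs. pencil_form \<alpha> A r)"
proof
  define P where "P = mat (length rs) \<alpha> (\<lambda>(k, j). (rs ! k) j)"
  have P: "P \<in> carrier_mat (length rs) \<alpha>" by (simp add: P_def)
  let ?S = "transpose_mat P * P"
  have "?S $$ (i, j) \<in> polys_deg_le 2" if "i < \<alpha>" "j < \<alpha>" for i j
  proof -
    have "?S $$ (i, j) = (\<Sum>k<length rs. (rs ! k) i * (rs ! k) j)"
      using that by (simp add: P_def scalar_prod_def atLeast0LessThan)
    moreover have "(rs ! k) i * (rs ! k) j \<in> polys_deg_le 2" if "k < length rs" for k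
      using polys_deg_le_mult[OF deg[OF nth_mem[OF that]] deg[OF nth_mem[OF that]]]
      by (simp add: numeral_2_eq_2)
    ultimately show ?thesis by (auto intro: polys_deg_le_sum)
  qed
  moreover have "?S \<in> carrier_mat \<alpha> \<alpha>" using P by simp
  ultimately have "elements_mat ?S \<subseteq> polys_deg_le 2"
    by (auto dest!: elements_matD)
  with P show "quadratic_sos_matrix \<alpha> ?S"
    by (auto simp: quadratic_sos_matrix_def sos_matrix_def)
  have "(\<Sum>k<length rs. pencil_form \<alpha> A (\<lambda>j. P $$ (k, j))) = (\<Sum>k<length rs. pencil_form \<alpha> A (rs ! k))"
    by (intro sum.cong refl) (simp add: P_def pencil_form_def)
  then show "mat_trace (A * ?S) = (\<Sum>r\<leftarrow>rs. pencil_form \<alpha> A r)"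
    by (simp add: mat_trace_mult_sos[OF A P] sum_list_sum_nth atLeast0LessThan)
qed

subsection \<open>Certificates for empty interior\<close>

lemma linear_pencilD:
  assumes "linear_pencil \<alpha> A"
  shows "A \<in> carrier_mat \<alpha> \<alpha>"
    and "\<And>i j. \<lbrakk>i < \<alpha>; j < \<alpha>\<rbrakk> \<Longrightarrow> A $$ (i, j) = A $$ (j, i)"
    and "\<And>i j. \<lbrakk>i < \<alpha>; j < \<alpha>\<rbrakk> \<Longrightarrow> A $$ (i, j) \<in> polys_deg_le 1"
proof -
  show A: "A \<in> carrier_mat \<alpha> \<alpha>" using assms by (simp add: linear_pencil_def)
  show "A $$ (i, j) = A $$ (j, i)" if "i < \<alpha>" "j < \<alpha>" for i j
    using assms that A index_transpose_mat(1)[of i A j] by (auto simp: linear_pencil_def)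
  show "A $$ (i, j) \<in> polys_deg_le 1" if "i < \<alpha>" "j < \<alpha>" for i j
    using assms that elements_matI[OF A that refl] by (auto simp: linear_pencil_def)
qed

lemma affine_coeffs_pencil_form:
  "affine_coeffs (pencil_form \<alpha> A (\<lambda>i. const_poly (u i)))
    = quad_form \<alpha> (\<lambda>i j. affine_coeffs (A $$ (i, j))) u"
  by (simp add: pencil_form_def quad_form_def affine_coeffs_sum mult_single affine_coeffs_const_mult)

lemma pencil_form_const_degree:
  assumes "linear_pencil \<alpha> A"
  shows "pencil_form \<alpha> A (\<lambda>i. const_poly (u i)) \<in> polys_deg_le 1"
  unfolding pencil_form_def using linear_pencilD(3)[OF assms]
  by (auto simp: mult_single intro!: polys_deg_le_intros)

lemma peval_pencil_form:
  "peval x (pencil_form \<alpha> A r) = (\<Sum>i<\<alpha>. \<Sum>j<\<alpha>. peval x (r i) * peval x (r j) * peval x (A $$ (i, j)))"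
  by (simp add: pencil_form_def peval_sum peval_mult)

lemma spectrahedron_iff:
  assumes "linear_pencil \<alpha> A"
  shows "x \<in> spectrahedron A
    \<longleftrightarrow> (\<forall>u. (\<Sum>i<\<alpha>. \<Sum>j<\<alpha>. u i * u j * peval x (A $$ (i, j))) \<ge> 0)" (is "_ \<longleftrightarrow> ?pos")
proof -
  note A = linear_pencilD[OF assms]
  let ?M = "map_mat (peval x) A"
  have M: "?M \<in> carrier_mat \<alpha> \<alpha>" using A(1) by simp
  have "transpose_mat ?M = ?M" using A(1,2) by (intro eq_matI) auto
  then have "x \<in> spectrahedron A \<longleftrightarrow> (\<forall>v\<in>carrier_vec \<alpha>. scalar_prod v (?M *\<^sub>v v) \<ge> 0)"
    using A(1) by (simp add: spectrahedron_def psd_mat_def)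
  also have "\<dots> \<longleftrightarrow> (\<forall>v\<in>carrier_vec \<alpha>.
      (\<Sum>i<\<alpha>. \<Sum>j<\<alpha>. vec_index v i * vec_index v j * peval x (A $$ (i, j))) \<ge> 0)"
  proof (intro ball_cong refl)
    fix v :: "real vec" assume "v \<in> carrier_vec \<alpha>"
    then have "scalar_prod v (?M *\<^sub>v v)
        = (\<Sum>i<\<alpha>. \<Sum>j<\<alpha>. vec_index v i * vec_index v j * peval x (A $$ (i, j)))"
      using A(1) by (auto simp: scalar_prod_def sum_distrib_left atLeast0LessThan mult_ac intro!: sum.cong)
    then show "scalar_prod v (?M *\<^sub>v v) \<ge> 0
        \<longleftrightarrow> (\<Sum>i<\<alpha>. \<Sum>j<\<alpha>. vec_index v i * vec_index v j * peval x (A $$ (i, j))) \<ge> 0" by simp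
  qed
  also have "\<dots> \<longleftrightarrow> ?pos"
  proof
    assume L: "\<forall>v\<in>carrier_vec \<alpha>.
      (\<Sum>i<\<alpha>. \<Sum>j<\<alpha>. vec_index v i * vec_index v j * peval x (A $$ (i, j))) \<ge> 0"
    show ?pos
    proof
      fix u
      show "(\<Sum>i<\<alpha>. \<Sum>j<\<alpha>. u i * u j * peval x (A $$ (i, j))) \<ge> 0"
        using L[rule_format, of "vec \<alpha> u"] by simp
    qed
  qed auto
  finally show ?thesis .
qed

text \<open>Describes the spectrahedron as the slice of the dual of the cone of values where the
  first coordinate is 1.\<close>

lemma spectrahedron_iff_quad_form:
  assumes "linear_pencil \<alpha> A"
  shows "x \<in> spectrahedron A
    \<longleftrightarrow> (\<forall>u. inner (1, x) (quad_form \<alpha> (\<lambda>i j. affine_coeffs (A $$ (i, j))) u) \<ge> 0)"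
proof -
  have "(\<Sum>i<\<alpha>. \<Sum>j<\<alpha>. u i * u j * peval x (A $$ (i, j)))
      = inner (1, x) (quad_form \<alpha> (\<lambda>i j. affine_coeffs (A $$ (i, j))) u)" for u
    unfolding quad_form_def inner_sum_right
    using linear_pencilD(3)[OF assms] by (intro sum.cong refl) (simp add: peval_affine)
  then show ?thesis by (simp add: spectrahedron_iff[OF assms])
qed

lemma certificate_imp_empty_interior:
  fixes A :: "('n::finite) rpoly mat"
  assumes pencil: "linear_pencil \<alpha> A" and f: "f \<in> polys_deg_le 1" "f \<noteq> 0"
    and S: "quadratic_sos_matrix \<alpha> S" and eq: "- (f ^ 2) = mat_trace (A * S)"
  shows "interior (spectrahedron A) = {}"
proof (rule ccontr)
  assume ne: "interior (spectrahedron A) \<noteq> {}"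
  obtain t P where P: "P \<in> carrier_mat t \<alpha>" and SP: "S = transpose_mat P * P"
    using S by (auto simp: quadratic_sos_matrix_def sos_matrix_def)
  have "inner (1, x) (affine_coeffs f) = 0" if x: "x \<in> interior (spectrahedron A)" for x
  proof -
    have "x \<in> spectrahedron A" using x interior_subset by blast
    \<comment> \<open>Each row of \<open>P\<close>, evaluated at \<open>x\<close>, is a real test
      vector for positive semidefiniteness.\<close>
    then have "peval x (pencil_form \<alpha> A (\<lambda>j. P $$ (k, j))) \<ge> 0" for k
      unfolding peval_pencil_form spectrahedron_iff[OF pencil]
      by (rule spec[of _ "\<lambda>j. peval x (P $$ (k, j))"])
    then have "peval x (- (f ^ 2)) \<ge> 0"
      unfolding eq SP mat_trace_mult_sos[OF linear_pencilD(1)[OF pencil] P] peval_sum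
      by (intro sum_nonneg) auto
    then have "(peval x f)\<^sup>2 \<le> 0"
      by (simp add: peval_uminus peval_mult power2_eq_square)
    then show ?thesis using f by (simp add: peval_affine)
  qed
  then have "affine_coeffs f = 0"
    using ne by (intro affine_zero_on_open[of "interior (spectrahedron A)"]) auto
  with f show False using affine_coeffs_eq_0 by blast
qed

lemma empty_interior_imp_certificate:
  fixes A :: "('n::finite) rpoly mat"
  assumes pencil: "linear_pencil \<alpha> A" and empty: "interior (spectrahedron A) = {}"
  shows "\<exists>f S. f \<in> polys_deg_le 1 \<and> f \<noteq> 0 \<and> quadratic_sos_matrix \<alpha> S \<and>
    - (f ^ 2) = mat_trace (A * S)"
proof (rule ccontr)
  assume "\<not> ?thesis"
  \<comment> \<open>Every list of affine rows whose forms add up to \<open>- (f ^ 2)\<close> is now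
    contradictory. This rules out the three obstructions in turn, so that an interior point can be
    produced.\<close>
  then have no_cert: False
    if "f \<in> polys_deg_le 1" "f \<noteq> 0" "\<And>r j. r \<in> set rs \<Longrightarrow> r j \<in> polys_deg_le 1"
      "(\<Sum>r\<leftarrow>rs. pencil_form \<alpha> A r) = - (f ^ 2)" for f and rs :: "(nat \<Rightarrow> 'n rpoly) list"
    using quadratic_sos_matrix_of_rows[OF linear_pencilD(1)[OF pencil], of rs] that by metis
  define a where "a = (\<lambda>i j. affine_coeffs (A $$ (i, j)))"
  define g where "g u = pencil_form \<alpha> A (\<lambda>i. const_poly (u i))" for u
  have g_deg: "g u \<in> polys_deg_le 1" for u
    unfolding g_def by (rule pencil_form_const_degree[OF pencil])
  have g_coeffs: "affine_coeffs (g u) = quad_form \<alpha> a u" for u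
    unfolding g_def a_def by (rule affine_coeffs_pencil_form)
  have sum_deg: "(\<Sum>u\<leftarrow>us. g u) \<in> polys_deg_le 1" for us
    by (intro polys_deg_le_sum_list g_deg)
  have sum_coeffs: "affine_coeffs (\<Sum>u\<leftarrow>us. g u) = (\<Sum>u\<leftarrow>us. quad_form \<alpha> a u)" for us
    by (simp add: affine_coeffs_sum_list g_coeffs)
  \<comment> \<open>Scalars enter the polynomial ring only as constant polynomials, so halves are
    cancelled through this identity.\<close>
  have two_halves: "const_poly (1/2) + const_poly (1/2) = (1 :: 'n rpoly)"
    by (simp flip: single_add)
  have kernel: "in_kernel \<alpha> a u" if u: "quad_form \<alpha> a u = 0" for u
  proof (rule ccontr)
    assume "\<not> in_kernel \<alpha> a u"
    then obtain i where i: "i < \<alpha>" "(\<Sum>j<\<alpha>. u j *\<^sub>R a i j) \<noteq> 0"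
      by (auto simp: in_kernel_def)
    \<comment> \<open>\<open>f\<close> is the \<open>i\<close>-th entry of \<open>A\<close> applied
      to \<open>u\<close>, and \<open>p\<close> solves
      \<open>2 * p + A $$ (i, i) = - 1\<close>.\<close>
    define f where "f = (\<Sum>j<\<alpha>. const_poly (u j) * A $$ (i, j))"
    define p where "p = - (const_poly (1/2) * (1 + A $$ (i, i)))"
    define r where "r j = p * const_poly (u j) + (if j = i then f else 0)" for j
    have f: "f \<in> polys_deg_le 1"
      unfolding f_def using linear_pencilD(3)[OF pencil] i by (auto intro!: polys_deg_le_intros)
    have "affine_coeffs f = (\<Sum>j<\<alpha>. u j *\<^sub>R a i j)"
      by (simp add: f_def affine_coeffs_sum affine_coeffs_const_mult a_def)
    with i have "f \<noteq> 0" by auto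
    have "p \<in> polys_deg_le 1"
      unfolding p_def using linear_pencilD(3)[OF pencil] i
      by (auto intro!: polys_deg_le_uminus polys_deg_le_intros)
    with f have r: "r j \<in> polys_deg_le 1" for j
      by (auto simp: r_def intro!: polys_deg_le_intros)
    have "g u = 0" using g_deg u by (intro affine_coeffs_eq_0) (simp_all add: g_coeffs)
    have "pencil_form \<alpha> A r = p ^ 2 * g u + 2 * f * (p * f) + f ^ 2 * A $$ (i, i)"
      unfolding r_def using linear_pencilD(2)[OF pencil] i(1)
      by (subst pencil_form_add_unit)
        (simp_all add: pencil_form_scale g_def f_def sum_distrib_left mult.assoc)
    also have "\<dots> = f ^ 2 * (p + p + A $$ (i, i))"
      by (simp add: \<open>g u = 0\<close> power2_eq_square algebra_simps)
    also have "p + p = - ((const_poly (1/2) + const_poly (1/2)) * (1 + A $$ (i, i)))"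
      by (simp add: p_def algebra_simps)
    also have "\<dots> = - (1 + A $$ (i, i))" by (simp only: two_halves mult_1_left)
    finally have "(\<Sum>r\<leftarrow>[r]. pencil_form \<alpha> A r) = - (f ^ 2)" by simp
    with no_cert[OF f \<open>f \<noteq> 0\<close>, of "[r]"] r show False by simp
  qed
  have pointed: "x = 0" if x: "x \<in> quad_cone \<alpha> a" "- x \<in> quad_cone \<alpha> a" for x
  proof (rule ccontr)
    assume "x \<noteq> 0"
    obtain us vs where us: "x = (\<Sum>u\<leftarrow>us. quad_form \<alpha> a u)" and vs: "- x = (\<Sum>u\<leftarrow>vs. quad_form \<alpha> a u)"
      using x by (auto simp: quad_cone_def)
    define G where "G = (\<Sum>u\<leftarrow>us. g u)"
    have G: "G \<in> polys_deg_le 1" unfolding G_def by (rule sum_deg)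
    have "affine_coeffs G = x" by (simp add: G_def sum_coeffs us)
    with \<open>x \<noteq> 0\<close> have "G \<noteq> 0" by auto
    have "G + (\<Sum>u\<leftarrow>vs. g u) = 0"
      using \<open>affine_coeffs G = x\<close>
      by (intro affine_coeffs_eq_0 polys_deg_le_add G sum_deg)
        (simp add: affine_coeffs_add sum_coeffs flip: vs)
    then have G': "(\<Sum>u\<leftarrow>vs. g u) = - G" by (metis add_eq_0_iff)
    \<comment> \<open>\<open>p\<close> and \<open>q\<close> solve \<open>p + q = - 1\<close> and
      \<open>p - q = G\<close>, so that \<open>p ^ 2 - q ^ 2 = - G\<close>.\<close>
    define p where "p = const_poly (1/2) * (G - 1)"
    define q where "q = const_poly (1/2) * (- 1 - G)"
    define row where "row p u j = p * const_poly (u j)" for p :: "'n rpoly" and u :: "nat \<Rightarrow> real" and j :: nat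
    have rows: "(\<Sum>r\<leftarrow>map (row p) us. pencil_form \<alpha> A r) = p ^ 2 * (\<Sum>u\<leftarrow>us. g u)" for p us
      by (induction us) (simp_all add: row_def[abs_def] pencil_form_scale g_def distrib_left)
    have "p \<in> polys_deg_le 1" "q \<in> polys_deg_le 1"
      unfolding p_def q_def using G polys_deg_le_uminus[OF polys_deg_le_1]
      by (auto intro!: polys_deg_le_intros)
    then have deg: "r j \<in> polys_deg_le 1" if "r \<in> set (map (row p) us @ map (row q) vs)" for r j
      using that by (auto simp: row_def intro!: polys_deg_le_intros)
    have "(\<Sum>r\<leftarrow>map (row p) us @ map (row q) vs. pencil_form \<alpha> A r) = p ^ 2 * G - q ^ 2 * G"
      unfolding map_append sum_list_append rows G' by (simp add: G_def)
    also have "\<dots> = (p + q) * (p - q) * G"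
      by (simp add: power2_eq_square algebra_simps)
    also have "p + q = - (const_poly (1/2) + const_poly (1/2))"
      by (simp add: p_def q_def algebra_simps)
    also have "p - q = (const_poly (1/2) + const_poly (1/2)) * G"
      by (simp add: p_def q_def algebra_simps)
    finally have "(\<Sum>r\<leftarrow>map (row p) us @ map (row q) vs. pencil_form \<alpha> A r) = - (G ^ 2)"
      unfolding two_halves by (simp add: power2_eq_square)
    with G \<open>G \<noteq> 0\<close> deg show False by (rule no_cert)
  qed
  have ray: "- (t *\<^sub>R (1, 0)) \<notin> quad_cone \<alpha> a" if t: "t > 0" for t
  proof
    assume "- (t *\<^sub>R (1, 0)) \<in> quad_cone \<alpha> a"
    then obtain us where us: "(\<Sum>u\<leftarrow>us. quad_form \<alpha> a u) = (- t, 0)"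
      by (auto simp: quad_cone_def)
    have "const_poly t + (\<Sum>u\<leftarrow>us. g u) = 0"
      by (intro affine_coeffs_eq_0 polys_deg_le_add polys_deg_le_const sum_deg)
        (simp add: affine_coeffs_add affine_coeffs_const sum_coeffs us zero_prod_def)
    moreover have "(\<Sum>r\<leftarrow>map (\<lambda>u i. const_poly (u i)) us. pencil_form \<alpha> A r) = (\<Sum>u\<leftarrow>us. g u)"
      by (simp add: o_def g_def)
    \<comment> \<open>A negative constant in the cone is minus the square of a nonzero constant, and
      the constant vectors in \<open>us\<close> already serve as rows.\<close>
    moreover have "const_poly t = const_poly (sqrt t) ^ 2"
      using t by (simp add: power2_eq_square mult_single)
    ultimately have eq: "(\<Sum>r\<leftarrow>map (\<lambda>u i. const_poly (u i)) us. pencil_form \<alpha> A r)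
        = - (const_poly (sqrt t) ^ 2)"
      by (metis add_eq_0_iff)
    have "const_poly (sqrt t) \<noteq> (0 :: 'n rpoly)" 
      using t by (metis lookup_single_eq lookup_zero real_sqrt_gt_zero less_irrefl)
    from no_cert[OF polys_deg_le_const this _ eq] show False by (auto intro: polys_deg_le_const)
  qed
  have "a i j = a j i" if "i < \<alpha>" "j < \<alpha>" for i j
    unfolding a_def using linear_pencilD(2)[OF pencil that] by simp
  from interior_functional[of \<alpha> a "(1, 0)", OF this kernel pointed ray]
  obtain l r where l: "inner l (1, 0) > 0" "r > 0"
    and near: "\<And>l' u. dist l l' < r \<Longrightarrow> inner l' (quad_form \<alpha> a u) \<ge> 0"
    by (auto simp: zero_prod_def)
  \<comment> \<open>The first coordinate of \<open>l\<close> is positive, so \<open>l\<close> can be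
    rescaled to the form \<open>(1, y)\<close>.\<close>
  define s y where "s = fst l" and "y = snd l /\<^sub>R s"
  have s: "s > 0" using l by (simp add: s_def inner_prod_def)
  have ly: "l = s *\<^sub>R (1, y)" using s by (simp add: y_def s_def prod_eq_iff)
  \<comment> \<open>For \<open>z\<close> in this ball, \<open>s *\<^sub>R (1, z)\<close> lies at
    distance \<open>s * norm (y - z) < r\<close> from \<open>l\<close>, so it is still nonnegative
    on all values of the form.\<close>
  have "ball y (r / s) \<subseteq> spectrahedron A"
  proof
    fix z assume "z \<in> ball y (r / s)"
    then have "s * norm (y - z) < r"
      using s by (simp add: dist_norm pos_less_divide_eq mult.commute)
    moreover have "l - s *\<^sub>R (1, z) = s *\<^sub>R (0, y - z)"
      by (simp add: ly scaleR_diff_right)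
    ultimately have "dist l (s *\<^sub>R (1, z)) < r"
      using s by (simp add: dist_norm norm_Pair)
    then have "s * inner (1, z) (quad_form \<alpha> a u) \<ge> 0" for u
      using near by (metis inner_scaleR_left)
    then show "z \<in> spectrahedron A"
      using s by (simp add: spectrahedron_iff_quad_form[OF pencil] zero_le_mult_iff flip: a_def)
  qed
  moreover have "y \<in> ball y (r / s)" using s l by simp
  ultimately have "y \<in> interior (spectrahedron A)" by (meson interiorI open_ball)
  with empty show False by simp
qed

theorem proposition3p3p1:
  fixes A :: "('n::finite) rpoly mat" and \<alpha> :: nat
  assumes "linear_pencil \<alpha> A"
  shows "interior (spectrahedron A) = {} \<longleftrightarrow>
    (\<exists>f S. f \<in> polys_deg_le 1 \<and> f \<noteq> 0 \<and> quadratic_sos_matrix \<alpha> S \<and>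
       - (f ^ 2) = mat_trace (A * S))"
  using certificate_imp_empty_interior[OF assms] empty_interior_imp_certificate[OF assms] by blast

end
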